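(* Let $(X,\tau)$ be a $c$-well-filtered space and $A$ a saturated subset of $X$. Then the subspace $(A,\tau_A)$, where $\tau_A$ is the subspace topology, is $c$-well-filtered.
   Context: A subset of a topological space is saturated if it is an intersection of open sets (equivalently, an upper set for the specialization order $x\le y\iff x\in\mathrm{cl}(\{y\})$). A subset $A$ is a Lindelöf set if every open cover of $A$ has a countable subcover. A nonempty family of sets is countably filtered if for every countable subfamily there is a member of the family contained in every member of the subfamily. A topological space $X$ is $c$-well-filtered if for every countably filtered family $\{K_i\}_{i\in I}$ of saturated Lindelöf subsets of $X$ and each open $U$ with $\bigcap_{i\in I}K_i\subseteq U$, there is $i_0\in I$ with $K_{i_0}\subseteq U$. *)

theory Defs
  imports "HOL-Analysis.Analysis"
begin

(* The intersection with topspace X makes the empty intersection the whole space, not UNIV. *)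
definition saturatedin :: "'a topology \<Rightarrow> 'a set \<Rightarrow> bool" where
  "saturatedin X S \<longleftrightarrow>
     (\<exists>\<U>. (\<forall>U\<in>\<U>. openin X U) \<and> S = topspace X \<inter> \<Inter>\<U>)"

(* Modelled on compactin: covers consist of open sets of the ambient space. *)
definition Lindelofin :: "'a topology \<Rightarrow> 'a set \<Rightarrow> bool" where
  "Lindelofin X S \<longleftrightarrow>
     S \<subseteq> topspace X \<and>
     (\<forall>\<U>. (\<forall>U\<in>\<U>. openin X U) \<and> S \<subseteq> \<Union>\<U>
        \<longrightarrow> (\<exists>\<V>. countable \<V> \<and> \<V> \<subseteq> \<U> \<and> S \<subseteq> \<Union>\<V>))"

definition countably_filtered :: "'a set set \<Rightarrow> bool" where
  "countably_filtered \<K> \<longleftrightarrow>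
     \<K> \<noteq> {} \<and>
     (\<forall>\<C>. \<C> \<subseteq> \<K> \<and> countable \<C> \<longrightarrow> (\<exists>K\<in>\<K>. \<forall>C\<in>\<C>. K \<subseteq> C))"

definition c_well_filtered :: "'a topology \<Rightarrow> bool" where
  "c_well_filtered X \<longleftrightarrow>
     (\<forall>\<K> U. countably_filtered \<K> \<and> (\<forall>K\<in>\<K>. saturatedin X K \<and> Lindelofin X K) \<and>
        openin X U \<and> \<Inter>\<K> \<subseteq> U
        \<longrightarrow> (\<exists>K\<in>\<K>. K \<subseteq> U))"

lemma saturatedin_iff_upper:
  "saturatedin X S \<longleftrightarrow>
     S \<subseteq> topspace X \<and>
     (\<forall>x\<in>S. \<forall>y\<in>topspace X. x \<in> X closure_of {y} \<longrightarrow> y \<in> S)"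
proof
  assume "saturatedin X S"
  then obtain \<U> where \<U>: "\<And>U. U \<in> \<U> \<Longrightarrow> openin X U" and S: "S = topspace X \<inter> \<Inter>\<U>"
    unfolding saturatedin_def by blast
  have "y \<in> S" if "x \<in> S" "y \<in> topspace X" "x \<in> X closure_of {y}" for x y
  proof -
    have "y \<in> U" if "U \<in> \<U>" for U
    proof -
      have "x \<in> U" "openin X U"
        using \<open>x \<in> S\<close> \<open>U \<in> \<U>\<close> \<U> S by blast+
      then show ?thesis
        using \<open>x \<in> X closure_of {y}\<close> unfolding in_closure_of by blast
    qed
    then show ?thesis
      using \<open>y \<in> topspace X\<close> unfolding S by simp
  qed
  moreover have "S \<subseteq> topspace X"
    unfolding S by simp
  ultimately show "S \<subseteq> topspace X \<and>
     (\<forall>x\<in>S. \<forall>y\<in>topspace X. x \<in> X closure_of {y} \<longrightarrow> y \<in> S)"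
    by simp
next
  assume R: "S \<subseteq> topspace X \<and>
     (\<forall>x\<in>S. \<forall>y\<in>topspace X. x \<in> X closure_of {y} \<longrightarrow> y \<in> S)"
  have "S = topspace X \<inter> \<Inter>{U. openin X U \<and> S \<subseteq> U}"
  proof
    show "S \<subseteq> topspace X \<inter> \<Inter>{U. openin X U \<and> S \<subseteq> U}"
      using R by blast
    show "topspace X \<inter> \<Inter>{U. openin X U \<and> S \<subseteq> U} \<subseteq> S"
    proof
      fix y assume y: "y \<in> topspace X \<inter> \<Inter>{U. openin X U \<and> S \<subseteq> U}"
      show "y \<in> S"
      proof (rule ccontr)
        assume "y \<notin> S"
        then have "S \<subseteq> topspace X - X closure_of {y}"
          using R y by blast
        moreover have "openin X (topspace X - X closure_of {y})"
          by (simp add: openin_diff)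
        ultimately have "y \<in> topspace X - X closure_of {y}"
          using y by blast
        then show False
          using y by (simp add: in_closure_of)
      qed
    qed
  qed
  moreover have "\<forall>U\<in>{U. openin X U \<and> S \<subseteq> U}. openin X U"
    by simp
  ultimately show "saturatedin X S"
    unfolding saturatedin_def by blast
qed

lemma Lindelofin_iff_Lindelof_space:
  "Lindelofin X S \<longleftrightarrow> S \<subseteq> topspace X \<and> Lindelof_space (subtopology X S)"
proof (cases "S \<subseteq> topspace X")
  case True
  then have top: "topspace (subtopology X S) = S"
    by auto
  show ?thesis
  proof
    assume L: "Lindelofin X S"
    have "\<exists>\<V>. countable \<V> \<and> \<V> \<subseteq> \<U> \<and> S \<subseteq> \<Union>\<V>"
      if \<U>: "\<forall>U\<in>\<U>. openin (subtopology X S) U" and cov: "S \<subseteq> \<Union>\<U>" for \<U>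
    proof -
      obtain g where g: "\<And>U. U \<in> \<U> \<Longrightarrow> openin X (g U) \<and> U = g U \<inter> S"
        using \<U> unfolding openin_subtopology by metis
      have "S \<subseteq> \<Union>(g ` \<U>)"
        using cov g by blast
      moreover have "\<forall>V \<in> g ` \<U>. openin X V"
        using g by blast
      ultimately obtain \<V> where "countable \<V>" "\<V> \<subseteq> g ` \<U>" "S \<subseteq> \<Union>\<V>"
        using L unfolding Lindelofin_def by meson
      then obtain \<W> where \<W>: "countable \<W>" "\<W> \<subseteq> \<U>" "\<V> = g ` \<W>"
        by (meson countable_subset_image)
      have "S \<subseteq> \<Union>\<W>"
      proof
        fix x assume x: "x \<in> S"
        then obtain U where "U \<in> \<W>" "x \<in> g U"
          using \<open>S \<subseteq> \<Union>\<V>\<close> \<W>(3) by blast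
        then have "x \<in> U"
          using g [of U] \<W>(2) x by blast
        then show "x \<in> \<Union>\<W>"
          using \<open>U \<in> \<W>\<close> by blast
      qed
      then show ?thesis
        using \<W> by blast
    qed
    then show "S \<subseteq> topspace X \<and> Lindelof_space (subtopology X S)"
      unfolding Lindelof_space_alt top using True by blast
  next
    assume "S \<subseteq> topspace X \<and> Lindelof_space (subtopology X S)"
    then have L: "Lindelof_space (subtopology X S)" ..
    have "\<exists>\<V>. countable \<V> \<and> \<V> \<subseteq> \<U> \<and> S \<subseteq> \<Union>\<V>"
      if \<U>: "\<forall>U\<in>\<U>. openin X U" and cov: "S \<subseteq> \<Union>\<U>" for \<U>
    proof -
      let ?\<T> = "(\<lambda>U. S \<inter> U) ` \<U>"
      have "\<forall>T\<in>?\<T>. openin (subtopology X S) T"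
        using \<U> by (auto intro: openin_subtopology_Int2)
      moreover have "S \<subseteq> \<Union>?\<T>"
        using cov by blast
      ultimately obtain \<V> where \<V>: "countable \<V>" "\<V> \<subseteq> ?\<T>" "S \<subseteq> \<Union>\<V>"
        using L unfolding Lindelof_space_alt top by meson
      then obtain \<W> where \<W>: "countable \<W>" "\<W> \<subseteq> \<U>" "\<V> = (\<lambda>U. S \<inter> U) ` \<W>"
        by (meson countable_subset_image)
      then have "S \<subseteq> \<Union>\<W>"
        using \<V>(3) by blast
      then show ?thesis
        using \<W> by blast
    qed
    then show "Lindelofin X S"
      unfolding Lindelofin_def using True by blast
  qed
qed (simp add: Lindelofin_def)

end

theory Submission
  imports Defs
begin

text \<open>
  Saturated Lindelof subsets of a saturated subspace \<open>A\<close> are saturated Lindelof in the whole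
  space \<open>X\<close>: being Lindelof is intrinsic, and saturation is transitive because an open set of
  \<open>A\<close> is the trace of an open set of \<open>X\<close> while \<open>A\<close> itself is an intersection of open sets. Hence
  a countably filtered family that is admissible in \<open>A\<close> is admissible in \<open>X\<close>. If its
  intersection lies in \<open>V \<inter> A\<close> with \<open>V\<close> open in \<open>X\<close>, then some member lies in \<open>V\<close>, and
  therefore in \<open>V \<inter> A\<close>.
\<close>

lemma saturatedin_subtopology_trans:
  assumes A: "saturatedin X A" and K: "saturatedin (subtopology X A) K"
  shows "saturatedin X K"
proof -
  obtain \<A> where \<A>: "\<forall>U\<in>\<A>. openin X U" "A = topspace X \<inter> \<Inter>\<A>"
    using A unfolding saturatedin_def by blast
  obtain \<U> where \<U>: "\<forall>U\<in>\<U>. openin (subtopology X A) U"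
      "K = topspace (subtopology X A) \<inter> \<Inter>\<U>"
    using K unfolding saturatedin_def by blast
  obtain g where g: "\<And>U. U \<in> \<U> \<Longrightarrow> openin X (g U) \<and> U = g U \<inter> A"
    using \<U>(1) unfolding openin_subtopology by metis
  have "K = A \<inter> \<Inter>\<U>"
    using \<U>(2) \<A>(2) by auto
  also have "\<dots> = A \<inter> \<Inter>(g ` \<U>)"
    using g by blast
  also have "\<dots> = topspace X \<inter> \<Inter>(\<A> \<union> g ` \<U>)"
    unfolding \<A>(2) by blast
  finally have "K = topspace X \<inter> \<Inter>(\<A> \<union> g ` \<U>)" .
  moreover have "\<forall>U\<in>\<A> \<union> g ` \<U>. openin X U"
    using \<A>(1) g by blast
  ultimately show ?thesis
    unfolding saturatedin_def by blast
qed

lemma Lindelofin_subtopology: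
  "Lindelofin (subtopology X A) K \<longleftrightarrow> K \<subseteq> A \<and> Lindelofin X K"
  by (auto simp: Lindelofin_iff_Lindelof_space subtopology_subtopology Int_absorb1)

theorem proposition3p8:
  fixes X :: "'a topology" and A :: "'a set"
  assumes "c_well_filtered X"
    and "saturatedin X A"
  shows "c_well_filtered (subtopology X A)"
  unfolding c_well_filtered_def
proof (intro allI impI, elim conjE)
  fix \<K> U
  assume filt: "countably_filtered \<K>"
    and \<K>: "\<forall>K\<in>\<K>. saturatedin (subtopology X A) K \<and> Lindelofin (subtopology X A) K"
    and U: "openin (subtopology X A) U" and sub: "\<Inter>\<K> \<subseteq> U"
  obtain V where V: "openin X V" "U = V \<inter> A"
    using U unfolding openin_subtopology by blast
  have "\<forall>K\<in>\<K>. saturatedin X K \<and> Lindelofin X K"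
    using \<K> saturatedin_subtopology_trans [OF assms(2)] by (simp add: Lindelofin_subtopology)
  moreover have "\<Inter>\<K> \<subseteq> V"
    using sub V(2) by blast
  ultimately obtain K where K: "K \<in> \<K>" "K \<subseteq> V"
    using assms(1) filt V(1) unfolding c_well_filtered_def by meson
  moreover have "K \<subseteq> A"
    using \<K> K(1) by (simp add: Lindelofin_subtopology)
  ultimately show "\<exists>K\<in>\<K>. K \<subseteq> U"
    using V(2) by blast
qed

end
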